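(* Assume $E[d_M(p_0,X)]<\infty$ and $E[d_N(q_0,Y)]<\infty$ for some $p_0\in M$ and $q_0\in N$. Then $$\inf_{m\in\mathcal M,\ \alpha\in(0,2)}F_\alpha(m)=\sqrt2\,\min\Big\{\inf_{p\in M}E[d_M(p,X)],\ \inf_{q\in N}E[d_N(q,Y)]\Big\}.$$
   Context: Let $(M,g_M)$ and $(N,g_N)$ be smooth, connected, complete Riemannian manifolds with geodesic distances $d_M,d_N$, and let $\mathcal M=M\times N$. For $\alpha\in(0,2)$, $m=(p,q)\in\mathcal M$ and $z=(x,y)\in\mathcal M$ put $d_\alpha(m,z)=\{\alpha d_M(p,x)^2+(2-\alpha)d_N(q,y)^2\}^{1/2}$. Let $Z=(X,Y)$ be a random element of $\mathcal M$ and define $F_\alpha(m)=E[d_\alpha(m,Z)]$. *)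

theory Defs
  imports "HOL-Probability.Probability"
begin

section \<open>Smooth maps\<close>

text \<open>On an open subset of a finite-dimensional space, continuity of all iterated
  directional derivatives up to order \<open>k\<close> is the usual notion of \<open>C\<^sup>k\<close>.\<close>

primrec Ck_on ::
  "nat \<Rightarrow> 'e::real_normed_vector set \<Rightarrow> ('e \<Rightarrow> 'f::real_normed_vector) \<Rightarrow> bool"
where
  "Ck_on 0 S f \<longleftrightarrow> continuous_on S f"
| "Ck_on (Suc k) S f \<longleftrightarrow>
     (\<forall>x\<in>S. f differentiable (at x)) \<and>
     (\<forall>v. Ck_on k S (\<lambda>x. frechet_derivative f (at x) v))"

definition smooth_on ::
  "'e::real_normed_vector set \<Rightarrow> ('e \<Rightarrow> 'f::real_normed_vector) \<Rightarrow> bool"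
  where "smooth_on S f \<longleftrightarrow> (\<forall>k. Ck_on k S f)"

section \<open>Smooth manifolds\<close>

text \<open>A manifold is a whole type \<open>'a\<close> with its topology, and \<open>'e\<close> is the model space of its
  charts. A chart is a pair of a domain and a coordinate map; the values of the coordinate map
  outside the domain are irrelevant. The model space is a finite-dimensional \<open>real_inner\<close> type
  rather than an \<open>euclidean_space\<close>, because the latter class excludes dimension 0. The atlas need
  not be maximal.\<close>

type_synonym ('a, 'e) chart = "'a set \<times> ('a \<Rightarrow> 'e)"

definition transition :: "('a, 'e) chart \<Rightarrow> ('a, 'e) chart \<Rightarrow> 'e \<Rightarrow> 'e"
  where "transition c c' = snd c' \<circ> inv_into (fst c) (snd c)"

locale smooth_manifold =
  fixes A :: "('a::{t2_space, second_countable_topology}, 'e::real_inner) chart set"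
  assumes finite_dim: "\<exists>B::'e set. finite B \<and> span B = UNIV"
    and chart_open: "(U, \<phi>) \<in> A \<Longrightarrow> open U \<and> open (\<phi> ` U)"
    and chart_homeomorphism: "(U, \<phi>) \<in> A \<Longrightarrow> homeomorphism U (\<phi> ` U) \<phi> (inv_into U \<phi>)"
    and charts_cover: "(\<Union>c\<in>A. fst c) = UNIV"
    and transition_smooth:
      "(U, \<phi>) \<in> A \<Longrightarrow> (V, \<psi>) \<in> A \<Longrightarrow>
        smooth_on (\<phi> ` (U \<inter> V)) (transition (U, \<phi>) (V, \<psi>))"

section \<open>Riemannian manifolds\<close>

text \<open>A Riemannian metric is given by its local expressions: for a chart \<open>c\<close> and a point \<open>p\<close> in
  its domain, \<open>g c p v w\<close> is the inner product of the tangent vectors at \<open>p\<close> whose coordinate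
  vectors with respect to \<open>c\<close> are \<open>v\<close> and \<open>w\<close>. The last assumption is the transformation law of a
  covariant 2-tensor, so that the local expressions define one inner product on each tangent
  space.\<close>

locale riemannian_manifold = smooth_manifold A
  for A :: "('a::{t2_space, second_countable_topology}, 'e::real_inner) chart set" +
  fixes g :: "('a, 'e) chart \<Rightarrow> 'a \<Rightarrow> 'e \<Rightarrow> 'e \<Rightarrow> real"
  assumes metric_bilinear: "c \<in> A \<Longrightarrow> p \<in> fst c \<Longrightarrow> bilinear (g c p)"
    and metric_sym: "c \<in> A \<Longrightarrow> p \<in> fst c \<Longrightarrow> g c p v w = g c p w v"
    and metric_pos: "c \<in> A \<Longrightarrow> p \<in> fst c \<Longrightarrow> v \<noteq> 0 \<Longrightarrow> 0 < g c p v v"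
    and metric_smooth:
      "(U, \<phi>) \<in> A \<Longrightarrow> smooth_on (\<phi> ` U) (\<lambda>x. g (U, \<phi>) (inv_into U \<phi> x) v w)"
    and metric_transform:
      "c \<in> A \<Longrightarrow> c' \<in> A \<Longrightarrow> p \<in> fst c \<Longrightarrow> p \<in> fst c' \<Longrightarrow>
        g c p v w =
          g c' p (frechet_derivative (transition c c') (at (snd c p)) v)
                 (frechet_derivative (transition c c') (at (snd c p)) w)"

section \<open>Length of curves and geodesic distance\<close>

text \<open>\<open>C1_arc\<close> takes one-sided derivatives at \<open>a\<close> and \<open>b\<close>. Hence the speed of a
  \<open>piecewise_C1_curve\<close> stays bounded near its break points, which
  \<open>piecewise_C1_differentiable_on\<close> would not guarantee.\<close>

definition C1_arc ::
  "('a::topological_space, 'e::real_normed_vector) chart set \<Rightarrow> real \<Rightarrow> real \<Rightarrow> (real \<Rightarrow> 'a) \<Rightarrow> bool"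
where
  "C1_arc A a b \<gamma> \<longleftrightarrow>
     continuous_on {a..b} \<gamma> \<and>
     (\<forall>(U, \<phi>)\<in>A. let T = {t \<in> {a..b}. \<gamma> t \<in> U} in
        \<exists>D. continuous_on T D \<and>
            (\<forall>t\<in>T. ((\<phi> \<circ> \<gamma>) has_vector_derivative D t) (at t within T)))"

definition piecewise_C1_curve ::
  "('a::topological_space, 'e::real_normed_vector) chart set \<Rightarrow> (real \<Rightarrow> 'a) \<Rightarrow> bool"
where
  "piecewise_C1_curve A \<gamma> \<longleftrightarrow>
     (\<exists>n (s :: nat \<Rightarrow> real). s 0 = 0 \<and> s n = 1 \<and>
        (\<forall>i<n. s i < s (Suc i) \<and> C1_arc A (s i) (s (Suc i)) \<gamma>))"

text \<open>By the transformation law, the speed does not depend on the chart that is chosen, except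
  possibly at the finitely many break points of the curve.\<close>

definition curve_speed ::
  "('a, 'e::real_normed_vector) chart set \<Rightarrow> (('a, 'e) chart \<Rightarrow> 'a \<Rightarrow> 'e \<Rightarrow> 'e \<Rightarrow> real) \<Rightarrow>
    (real \<Rightarrow> 'a) \<Rightarrow> real \<Rightarrow> real"
where
  "curve_speed A g \<gamma> t =
     (let c = (SOME c. c \<in> A \<and> \<gamma> t \<in> fst c);
          v = vector_derivative (snd c \<circ> \<gamma>) (at t within {0..1})
      in sqrt (g c (\<gamma> t) v v))"

definition curve_length ::
  "('a, 'e::real_normed_vector) chart set \<Rightarrow> (('a, 'e) chart \<Rightarrow> 'a \<Rightarrow> 'e \<Rightarrow> 'e \<Rightarrow> real) \<Rightarrow>
    (real \<Rightarrow> 'a) \<Rightarrow> real"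
  where "curve_length A g \<gamma> = integral {0..1} (curve_speed A g \<gamma>)"

definition geodesic_dist ::
  "('a::topological_space, 'e::real_normed_vector) chart set \<Rightarrow>
    (('a, 'e) chart \<Rightarrow> 'a \<Rightarrow> 'e \<Rightarrow> 'e \<Rightarrow> real) \<Rightarrow> 'a \<Rightarrow> 'a \<Rightarrow> real"
where
  "geodesic_dist A g p q =
     Inf {curve_length A g \<gamma> | \<gamma>.
            piecewise_C1_curve A \<gamma> \<and> pathstart \<gamma> = p \<and> pathfinish \<gamma> = q}"

locale complete_connected_riemannian_manifold = riemannian_manifold A g
  for A :: "('a::{t2_space, second_countable_topology}, 'e::real_inner) chart set"
  and g :: "('a, 'e) chart \<Rightarrow> 'a \<Rightarrow> 'e \<Rightarrow> 'e \<Rightarrow> real" +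
  assumes manifold_connected: "connected (UNIV :: 'a set)"
    and manifold_complete: "Metric_space.mcomplete UNIV (geodesic_dist A g)"

section \<open>Weighted product distances and their mean\<close>

definition weighted_dist ::
  "('a \<Rightarrow> 'a \<Rightarrow> real) \<Rightarrow> ('b \<Rightarrow> 'b \<Rightarrow> real) \<Rightarrow> real \<Rightarrow> 'a \<times> 'b \<Rightarrow> 'a \<times> 'b \<Rightarrow> real"
where
  "weighted_dist dM dN \<alpha> m z =
     sqrt (\<alpha> * (dM (fst m) (fst z))\<^sup>2 + (2 - \<alpha>) * (dN (snd m) (snd z))\<^sup>2)"

definition mean_weighted_dist ::
  "('a \<Rightarrow> 'a \<Rightarrow> real) \<Rightarrow> ('b \<Rightarrow> 'b \<Rightarrow> real) \<Rightarrow> 'w measure \<Rightarrow> ('w \<Rightarrow> 'a \<times> 'b) \<Rightarrow>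
    real \<Rightarrow> 'a \<times> 'b \<Rightarrow> real"
where
  "mean_weighted_dist dM dN P Z \<alpha> m =
     prob_space.expectation P (\<lambda>\<omega>. weighted_dist dM dN \<alpha> m (Z \<omega>))"

end

theory Submission
  imports Defs
begin

text \<open>Write \<open>a = d\<^sub>M\<close>, \<open>b = d\<^sub>N\<close> and \<open>\<theta> = \<alpha>/2\<close>, so that
  \<open>d\<^sub>\<alpha> = \<surd>2 \<surd>(\<theta> a\<^sup>2 + (1 - \<theta>) b\<^sup>2)\<close>. Convexity of the square gives
  \<open>d\<^sub>\<alpha> \<ge> \<surd>2 (\<theta> a + (1 - \<theta>) b)\<close>, whose mean is at least \<open>\<surd>2\<close> times the smaller of the two
  infima. Conversely \<open>d\<^sub>\<alpha> \<le> \<surd>\<alpha> a + \<surd>(2 - \<alpha>) b\<close>, and \<open>\<alpha>\<close> tends to 2 or to 0.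

  The geometric input is that \<open>d\<^sub>M(p, X)\<close> is an integrable random variable for every \<open>p\<close>. The
  triangle inequality reduces this to measurability. For the latter it suffices that
  \<open>d\<^sub>M(p, \<cdot>)\<close> is upper semicontinuous, which follows from the triangle inequality once
  \<open>d\<^sub>M(x, y) \<rightarrow> 0\<close> as \<open>y \<rightarrow> x\<close>; this is seen by joining \<open>x\<close> to \<open>y\<close> by a segment in a chart.\<close>

section \<open>Local bounds for the metric tensor\<close>

text \<open>The difference of the two sides lies in the span of \<open>C\<close> and is orthogonal
  to every element of \<open>C\<close>, hence to itself. A zero vector in \<open>C\<close> does no
  harm, because its coefficient is 0 / 0 = 0.\<close>

lemma orthogonal_spanning_expansion:
  fixes C :: "'e::real_inner set"
  assumes "finite C" "pairwise orthogonal C" "w \<in> span C"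
  shows "w = (\<Sum>b\<in>C. (w \<bullet> b / (b \<bullet> b)) *\<^sub>R b)"
proof -
  define u where "u = w - (\<Sum>b\<in>C. (w \<bullet> b / (b \<bullet> b)) *\<^sub>R b)"
  have "u \<in> span C"
    unfolding u_def by (intro span_diff assms span_sum span_scale span_base)
  moreover have "orthogonal u c" if "c \<in> C" for c
  proof -
    have "(\<Sum>b\<in>C. (w \<bullet> b / (b \<bullet> b)) *\<^sub>R b) \<bullet> c = (\<Sum>b\<in>C. (w \<bullet> b / (b \<bullet> b)) * (b \<bullet> c))"
      by (simp add: inner_sum_left)
    also have "\<dots> = (\<Sum>b\<in>C. if b = c then w \<bullet> c else 0)"
      using assms(2) that
      by (intro sum.cong) (auto simp: pairwise_def orthogonal_def)
    also have "\<dots> = w \<bullet> c"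
      using assms(1) that by simp
    finally show ?thesis
      by (simp add: u_def orthogonal_def inner_diff_left)
  qed
  ultimately have "orthogonal u u"
    by (rule orthogonal_to_span)
  then show ?thesis
    by (simp add: u_def orthogonal_self)
qed

text \<open>After \<open>w\<close> is expanded along \<open>C\<close>, the Cauchy-Schwarz inequality
  bounds each coefficient by a multiple of \<open>norm w\<close>. The constant depends on
  \<open>h\<close> only through its finitely many values on \<open>C \<times> C\<close>; when
  \<open>h\<close> varies with a base point, continuity of these values makes the bound locally
  uniform.\<close>

lemma bilinear_diag_bound:
  fixes C :: "'e::real_inner set" and h :: "'e \<Rightarrow> 'e \<Rightarrow> real"
  assumes C: "finite C" "pairwise orthogonal C" "span C = UNIV"
    and h: "bilinear h"
  shows "h w w \<le> (\<Sum>(b,c)\<in>C\<times>C. norm b / (b \<bullet> b) * (norm c / (c \<bullet> c)) * \<bar>h b c\<bar>) * (norm w)\<^sup>2"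
proof -
  let ?k = "\<lambda>b. w \<bullet> b / (b \<bullet> b)"
  have k: "\<bar>?k b\<bar> \<le> norm w * (norm b / (b \<bullet> b))" for b
    using Cauchy_Schwarz_ineq2[of w b] by (simp add: divide_right_mono)
  have w: "w = (\<Sum>b\<in>C. ?k b *\<^sub>R b)"
    using C by (intro orthogonal_spanning_expansion) auto
  have "h w w = h (\<Sum>b\<in>C. ?k b *\<^sub>R b) (\<Sum>b\<in>C. ?k b *\<^sub>R b)"
    using w by simp
  also have "\<dots> = (\<Sum>(b,c)\<in>C\<times>C. h (?k b *\<^sub>R b) (?k c *\<^sub>R c))"
    by (rule bilinear_sum[OF h])
  also have "\<dots> = (\<Sum>(b,c)\<in>C\<times>C. ?k b * ?k c * h b c)"
    by (simp add: bilinear_lmul[OF h] bilinear_rmul[OF h] mult.assoc mult.commute mult.left_commute)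
  also have "\<dots> \<le> (\<Sum>(b,c)\<in>C\<times>C. (norm w * (norm b / (b \<bullet> b))) * (norm w * (norm c / (c \<bullet> c))) * \<bar>h b c\<bar>)"
  proof (intro sum_mono, clarify)
    fix b c
    have "?k b * ?k c * h b c \<le> \<bar>?k b\<bar> * \<bar>?k c\<bar> * \<bar>h b c\<bar>"
      by (metis abs_ge_self abs_mult)
    also have "\<dots> \<le> (norm w * (norm b / (b \<bullet> b))) * (norm w * (norm c / (c \<bullet> c))) * \<bar>h b c\<bar>"
      by (intro mult_right_mono mult_mono k) auto
    finally show "?k b * ?k c * h b c
        \<le> (norm w * (norm b / (b \<bullet> b))) * (norm w * (norm c / (c \<bullet> c))) * \<bar>h b c\<bar>" .
  qed
  also have "\<dots> = (\<Sum>(b,c)\<in>C\<times>C. norm b / (b \<bullet> b) * (norm c / (c \<bullet> c)) * \<bar>h b c\<bar>) * (norm w)\<^sup>2"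
    unfolding sum_distrib_right by (intro sum.cong) (auto simp: power2_eq_square)
  finally show ?thesis .
qed

lemma smooth_on_continuous: "smooth_on S f \<Longrightarrow> continuous_on S f"
  unfolding smooth_on_def by (metis Ck_on.simps(1))

lemma smooth_on_differentiable: "smooth_on S f \<Longrightarrow> x \<in> S \<Longrightarrow> f differentiable (at x)"
  unfolding smooth_on_def by (metis Ck_on.simps(2))

lemma smooth_on_frechet_continuous:
  "smooth_on S f \<Longrightarrow> continuous_on S (\<lambda>x. frechet_derivative f (at x) v)"
  unfolding smooth_on_def by (metis Ck_on.simps)

section \<open>Joins of curves\<close>

text \<open>The chain rule for an increasing affine change of time. Agreement of
  \<open>\<delta>\<close> with the reparametrised curve is asked on \<open>{a..b}\<close> only,
  since a join of curves follows each of its pieces on one half of the time interval.\<close>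

lemma C1_arc_reparam:
  assumes arc: "C1_arc A (m * a + k) (m * b + k) \<gamma>" and m: "m > 0"
    and \<delta>: "\<And>t. t \<in> {a..b} \<Longrightarrow> \<delta> t = \<gamma> (m * t + k)"
  shows "C1_arc A a b \<delta>"
proof -
  let ?f = "\<lambda>t. m * t + k"
  have f: "?f t \<in> {m * a + k..m * b + k}" if "t \<in> {a..b}" for t
    using that m by auto
  have "continuous_on {a..b} (\<gamma> \<circ> ?f)"
    using arc f unfolding C1_arc_def
    by (intro continuous_on_compose) (auto intro!: continuous_intros elim: continuous_on_subset)
  then have "continuous_on {a..b} \<delta>"
    by (rule continuous_on_eq) (simp add: \<delta>)
  moreover have "\<exists>D. continuous_on T D \<and> (\<forall>t\<in>T. ((\<phi> \<circ> \<delta>) has_vector_derivative D t) (at t within T))"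
    if c: "(U, \<phi>) \<in> A" and T: "T = {t \<in> {a..b}. \<delta> t \<in> U}" for U \<phi> T
  proof -
    define T' where "T' = {t \<in> {m * a + k..m * b + k}. \<gamma> t \<in> U}"
    obtain D where D: "continuous_on T' D"
        "\<And>t. t \<in> T' \<Longrightarrow> ((\<phi> \<circ> \<gamma>) has_vector_derivative D t) (at t within T')"
      using arc c unfolding C1_arc_def Let_def T'_def by fast
    have sub: "?f ` T \<subseteq> T'"
      using f \<delta> by (auto simp: T T'_def)
    show ?thesis
    proof (intro exI conjI ballI)
      show "continuous_on T (\<lambda>t. m *\<^sub>R (D \<circ> ?f) t)"
        by (intro continuous_on_scaleR continuous_on_const continuous_on_compose
            continuous_on_subset[OF D(1) sub]) (auto intro!: continuous_intros)
      fix t assume t: "t \<in> T"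
      have "(?f has_vector_derivative m) (at t within T)"
        by (auto intro!: derivative_eq_intros simp: has_vector_derivative_def)
      moreover have "((\<phi> \<circ> \<gamma>) has_vector_derivative D (?f t)) (at (?f t) within ?f ` T)"
        using D(2) sub t by (intro has_vector_derivative_within_subset[OF _ sub]) auto
      ultimately have "(((\<phi> \<circ> \<gamma>) \<circ> ?f) has_vector_derivative m *\<^sub>R D (?f t)) (at t within T)"
        by (rule vector_diff_chain_within)
      then show "((\<phi> \<circ> \<delta>) has_vector_derivative m *\<^sub>R (D \<circ> ?f) t) (at t within T)"
        using t \<delta> by (auto simp: T intro: has_vector_derivative_transform[rotated 2])
    qed
  qed
  ultimately show ?thesis
    unfolding C1_arc_def Let_def by auto
qed

lemma partition_mono:
  fixes s :: "nat \<Rightarrow> real"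
  assumes "\<And>i. i < n \<Longrightarrow> s i < s (Suc i)" and "i \<le> j" "j \<le> n"
  shows "s i \<le> s j"
  using assms(2,3)
proof (induction rule: dec_induct)
  case (step k)
  then show ?case using assms(1)[of k] by simp
qed simp

lemma partition_cover:
  fixes s :: "nat \<Rightarrow> real"
  assumes "s 0 \<le> t" "t \<le> s n"
  shows "t \<in> s ` {..n} \<or> (\<exists>i<n. s i < t \<and> t < s (Suc i))"
  using assms
proof (induction n)
  case (Suc n)
  show ?case
  proof (cases "t \<le> s n")
    case True
    with Suc show ?thesis by (auto simp: less_Suc_eq)
  next
    case False
    with Suc.prems show ?thesis by (cases "t = s (Suc n)") auto
  qed
qed auto

lemma piecewise_C1_curve_join:
  assumes c1: "piecewise_C1_curve A \<gamma>1" and c2: "piecewise_C1_curve A \<gamma>2"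
    and eq: "pathfinish \<gamma>1 = pathstart \<gamma>2"
  shows "piecewise_C1_curve A (\<gamma>1 +++ \<gamma>2)"
proof -
  obtain n1 s1 where s1: "s1 0 = 0" "s1 n1 = 1"
      "\<And>i. i < n1 \<Longrightarrow> s1 i < s1 (Suc i)" "\<And>i. i < n1 \<Longrightarrow> C1_arc A (s1 i) (s1 (Suc i)) \<gamma>1"
    using c1 unfolding piecewise_C1_curve_def by blast
  obtain n2 s2 where s2: "s2 0 = 0" "s2 n2 = 1"
      "\<And>i. i < n2 \<Longrightarrow> s2 i < s2 (Suc i)" "\<And>i. i < n2 \<Longrightarrow> C1_arc A (s2 i) (s2 (Suc i)) \<gamma>2"
    using c2 unfolding piecewise_C1_curve_def by blast
  \<comment> \<open>The first partition is compressed into [0, 1/2] and the second into [1/2, 1]. At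
    index \<open>n1\<close> both formulas give 1/2, so \<open>sr\<close> holds for
    \<open>j = 0\<close> as well.\<close>
  define s where "s i = (if i \<le> n1 then s1 i / 2 else 1/2 + s2 (i - n1) / 2)" for i
  have sl: "s i = s1 i / 2" if "i \<le> n1" for i
    using that by (simp add: s_def)
  have sr: "s (n1 + j) = 1/2 + s2 j / 2" for j
    using s1(2) s2(1) by (cases "j = 0") (auto simp: s_def)
  have "s i < s (Suc i) \<and> C1_arc A (s i) (s (Suc i)) (\<gamma>1 +++ \<gamma>2)" if i: "i < n1 + n2" for i
  proof (cases "i < n1")
    case True
    have "s1 (Suc i) \<le> 1"
      using partition_mono[of n1 s1 "Suc i" n1] s1 True by simp
    then have eq_piece: "(\<gamma>1 +++ \<gamma>2) t = \<gamma>1 (2 * t + 0)" if "t \<in> {s i..s (Suc i)}" for t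
      using that True by (auto simp: joinpaths_def sl)
    have "C1_arc A (2 * s i + 0) (2 * s (Suc i) + 0) \<gamma>1"
      using s1(4)[OF True] True by (simp add: sl)
    then have "C1_arc A (s i) (s (Suc i)) (\<gamma>1 +++ \<gamma>2)"
      by (rule C1_arc_reparam[where m = 2 and k = 0 and \<gamma> = \<gamma>1, OF _ _ eq_piece]) simp_all
    then show ?thesis
      using s1(3)[OF True] True by (simp add: sl)
  next
    case False
    then obtain j where "i = n1 + j"
      using le_Suc_ex by (meson not_less)
    then have j: "i = n1 + j" "Suc i = n1 + Suc j" "j < n2"
      using i by auto
    have sj: "s i = 1/2 + s2 j / 2" "s (Suc i) = 1/2 + s2 (Suc j) / 2"
      using sr[of j] sr[of "Suc j"] j by simp_all
    have s2j: "0 \<le> s2 j"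
      using partition_mono[of n2 s2 0 j] s2 j by simp
    \<comment> \<open>At time 1/2 the join still follows \<open>\<gamma>1\<close>; there the
      matching of the end points is used.\<close>
    have eq_piece: "(\<gamma>1 +++ \<gamma>2) t = \<gamma>2 (2 * t + - 1)" if "t \<in> {s i..s (Suc i)}" for t
    proof (cases "t = 1/2")
      case True
      show ?thesis
        using eq unfolding True by (simp add: joinpaths_def pathstart_def pathfinish_def)
    next
      case False
      then show ?thesis
        using that s2j unfolding sj by (auto simp: joinpaths_def)
    qed
    have "C1_arc A (2 * s i + - 1) (2 * s (Suc i) + - 1) \<gamma>2"
      using s2(4)[OF j(3)] unfolding sj by simp
    then have "C1_arc A (s i) (s (Suc i)) (\<gamma>1 +++ \<gamma>2)"
      by (rule C1_arc_reparam[where m = 2 and k = "- 1" and \<gamma> = \<gamma>2, OF _ _ eq_piece]) simp_all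
    then show ?thesis
      using s2(3)[OF j(3)] unfolding sj by simp
  qed
  moreover have "s 0 = 0" "s (n1 + n2) = 1"
    using s1 s2 sr by (auto simp: sl)
  ultimately show ?thesis
    unfolding piecewise_C1_curve_def by blast
qed

section \<open>Charts, the local bound for the metric, and the sign of speed and length\<close>

context riemannian_manifold
begin

lemma chart_at: obtains U \<phi> where "(U, \<phi>) \<in> A" "x \<in> U"
  using charts_cover by fastforce

lemma
  assumes "(U, \<phi>) \<in> A"
  shows chart_open_domain: "open U"
    and chart_open_image: "open (\<phi> ` U)"
    and chart_continuous: "continuous_on U \<phi>"
    and chart_inverse_continuous: "continuous_on (\<phi> ` U) (inv_into U \<phi>)"
    and chart_inverse: "x \<in> U \<Longrightarrow> inv_into U \<phi> (\<phi> x) = x"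
  using chart_open[OF assms] chart_homeomorphism[OF assms] unfolding homeomorphism_def by auto

text \<open>Each of the finitely many coefficients of the metric with respect to an orthogonal
  spanning set is continuous, so near \<open>\<phi> x\<close> its absolute value exceeds the value
  at \<open>\<phi> x\<close> by less than 1. These enlarged values enter
  \<open>bilinear_diag_bound\<close> and give \<open>K\<close>.\<close>

lemma metric_locally_bounded:
  assumes c: "(U, \<phi>) \<in> A" and x: "x \<in> U"
  obtains r K where "r > 0" "K \<ge> 0" "ball (\<phi> x) r \<subseteq> \<phi> ` U"
    "\<And>y w. y \<in> ball (\<phi> x) r \<Longrightarrow> g (U, \<phi>) (inv_into U \<phi> y) w w \<le> K * (norm w)\<^sup>2"
proof -
  let ?g = "\<lambda>y. g (U, \<phi>) (inv_into U \<phi> y)"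
  obtain C :: "'e set" where C: "finite C" "pairwise orthogonal C" "span C = UNIV"
    using finite_dim basis_orthogonal by metis
  have op: "open (\<phi> ` U)" and mem: "\<phi> x \<in> \<phi> ` U"
    using chart_open_image[OF c] x by auto
  have "eventually (\<lambda>y. \<bar>?g y b c\<bar> < \<bar>?g (\<phi> x) b c\<bar> + 1) (nhds (\<phi> x))" for b c
  proof -
    have "isCont (\<lambda>y. ?g y b c) (\<phi> x)"
      using smooth_on_continuous[OF metric_smooth[OF c]] op mem continuous_on_eq_continuous_at by blast
    then have "((\<lambda>y. \<bar>?g y b c\<bar>) \<longlongrightarrow> \<bar>?g (\<phi> x) b c\<bar>) (nhds (\<phi> x))"
      by (intro tendsto_rabs) (simp add: isCont_def tendsto_at_iff_tendsto_nhds[of "\<lambda>y. ?g y b c"])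
    then show ?thesis
      by (rule order_tendstoD) simp
  qed
  then have "eventually (\<lambda>y. \<forall>(b,c)\<in>C\<times>C. \<bar>?g y b c\<bar> < \<bar>?g (\<phi> x) b c\<bar> + 1) (nhds (\<phi> x))"
    using C(1) by (intro eventually_ball_finite) auto
  moreover have "eventually (\<lambda>y. y \<in> \<phi> ` U) (nhds (\<phi> x))"
    using op mem by (rule eventually_nhds_in_open)
  ultimately have "eventually (\<lambda>y. y \<in> \<phi> ` U \<and>
      (\<forall>(b,c)\<in>C\<times>C. \<bar>?g y b c\<bar> < \<bar>?g (\<phi> x) b c\<bar> + 1)) (nhds (\<phi> x))"
    by (simp add: eventually_conj)
  then obtain r where r: "r > 0" and *: "\<And>y. dist y (\<phi> x) < r \<Longrightarrow> y \<in> \<phi> ` U \<and>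
      (\<forall>(b,c)\<in>C\<times>C. \<bar>?g y b c\<bar> < \<bar>?g (\<phi> x) b c\<bar> + 1)"
    unfolding eventually_nhds_metric by blast
  define K where "K = (\<Sum>(b,c)\<in>C\<times>C. norm b / (b \<bullet> b) * (norm c / (c \<bullet> c)) * (\<bar>?g (\<phi> x) b c\<bar> + 1))"
  have "K \<ge> 0"
    unfolding K_def by (intro sum_nonneg) auto
  moreover have "ball (\<phi> x) r \<subseteq> \<phi> ` U"
    using * by (force simp: dist_commute)
  moreover have "?g y w w \<le> K * (norm w)\<^sup>2" if "y \<in> ball (\<phi> x) r" for y w
  proof -
    have y: "y \<in> \<phi> ` U" "\<forall>(b,c)\<in>C\<times>C. \<bar>?g y b c\<bar> < \<bar>?g (\<phi> x) b c\<bar> + 1"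
      using *[of y] that by (auto simp: dist_commute)
    have "bilinear (?g y)"
      using metric_bilinear[OF c] y(1) by (simp add: inv_into_into)
    from bilinear_diag_bound[OF C this]
    have "?g y w w \<le> (\<Sum>(b,c)\<in>C\<times>C. norm b / (b \<bullet> b) * (norm c / (c \<bullet> c)) * \<bar>?g y b c\<bar>) * (norm w)\<^sup>2" .
    also have "\<dots> \<le> K * (norm w)\<^sup>2"
      unfolding K_def using y(2)
      by (intro mult_right_mono sum_mono)
        (auto intro!: mult_left_mono intro: less_imp_le simp del: times_divide_eq_left times_divide_eq_right)
    finally show ?thesis .
  qed
  ultimately show thesis
    using r that by blast
qed

text \<open>Gives a name and the expected properties to the chart that \<open>curve_speed\<close>
  selects by Hilbert choice.\<close>

lemma speed_chart:
  obtains c where "c \<in> A" "x \<in> fst c" "(SOME c. c \<in> A \<and> x \<in> fst c) = c"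
proof -
  have "\<exists>c. c \<in> A \<and> x \<in> fst c"
    using charts_cover by blast
  from someI_ex[OF this] show thesis
    by (intro that[OF _ _ refl]) auto
qed

lemma metric_nonneg: "c \<in> A \<Longrightarrow> p \<in> fst c \<Longrightarrow> 0 \<le> g c p v v"
  using metric_pos[of c p v] bilinear_lzero[OF metric_bilinear, of c p v]
  by (cases "v = 0") (auto simp: less_imp_le)

lemma curve_speed_nonneg: "0 \<le> curve_speed A g \<gamma> t"
  unfolding curve_speed_def Let_def
  by (rule speed_chart[of "\<gamma> t"]) (simp only: real_sqrt_ge_zero metric_nonneg)

lemma curve_length_nonneg: "0 \<le> curve_length A g \<gamma>"
  unfolding curve_length_def
  by (cases "curve_speed A g \<gamma> integrable_on {0..1}")
    (auto simp: not_integrable_integral curve_speed_nonneg intro: integral_nonneg)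

section \<open>Straight segments in a chart\<close>

context
  fixes U \<phi> a b
  assumes c: "(U, \<phi>) \<in> A" and seg: "closed_segment a b \<subseteq> \<phi> ` U"
begin

text \<open>Seen from \<open>(V, \<psi>)\<close>, the curve is a transition map after a straight
  line of velocity \<open>b - a\<close>. The set \<open>S\<close> is left free: an arc needs the
  derivative within the times spent in \<open>V\<close>, the speed needs it within [0, 1].\<close>

lemma chart_segment_derivative:
  assumes V: "(V, \<psi>) \<in> A" and t: "t \<in> {0..1}" and tV: "inv_into U \<phi> (linepath a b t) \<in> V"
  shows "linepath a b t \<in> \<phi> ` (U \<inter> V)"
    and "((\<psi> \<circ> (inv_into U \<phi> \<circ> linepath a b)) has_vector_derivative
      frechet_derivative (transition (U, \<phi>) (V, \<psi>)) (at (linepath a b t)) (b - a)) (at t within S)"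
proof -
  have im: "linepath a b t \<in> \<phi> ` U"
    using seg t linepath_image_01[of a b] by blast
  have "linepath a b t = \<phi> (inv_into U \<phi> (linepath a b t))"
    using im by (simp add: f_inv_into_f)
  then show mem: "linepath a b t \<in> \<phi> ` (U \<inter> V)"
    using im tV by (metis IntI image_eqI inv_into_into)
  let ?f = "transition (U, \<phi>) (V, \<psi>)"
  have "(?f has_derivative frechet_derivative ?f (at (linepath a b t))) (at (linepath a b t))"
    using smooth_on_differentiable[OF transition_smooth[OF c V] mem]
    by (simp add: frechet_derivative_works)
  then have "((?f \<circ> linepath a b) has_vector_derivative
      frechet_derivative ?f (at (linepath a b t)) (b - a)) (at t within S)"
    by (rule vector_derivative_diff_chain_within
      [OF has_vector_derivative_linepath_within has_derivative_at_withinI])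
  then show "((\<psi> \<circ> (inv_into U \<phi> \<circ> linepath a b)) has_vector_derivative
      frechet_derivative ?f (at (linepath a b t)) (b - a)) (at t within S)"
    by (simp add: transition_def comp_assoc)
qed

lemma chart_segment_curve: "piecewise_C1_curve A (inv_into U \<phi> \<circ> linepath a b)"
proof -
  let ?\<gamma> = "inv_into U \<phi> \<circ> linepath a b"
  have "linepath a b ` {0..1} \<subseteq> \<phi> ` U"
    using seg by (simp add: linepath_image_01)
  then have "continuous_on {0..1} ?\<gamma>"
    using continuous_on_subset[OF chart_inverse_continuous[OF c]]
    by (intro continuous_on_compose continuous_on_linepath) auto
  moreover have "\<exists>D. continuous_on T D \<and> (\<forall>t\<in>T. ((\<psi> \<circ> ?\<gamma>) has_vector_derivative D t) (at t within T))"
    if V: "(V, \<psi>) \<in> A" and T: "T = {t \<in> {0..1}. ?\<gamma> t \<in> V}" for V \<psi> T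
  proof (intro exI conjI ballI)
    let ?D = "\<lambda>x. frechet_derivative (transition (U, \<phi>) (V, \<psi>)) (at x) (b - a)"
    have "linepath a b ` T \<subseteq> \<phi> ` (U \<inter> V)"
      using chart_segment_derivative(1)[OF V] T by auto
    then show "continuous_on T (?D \<circ> linepath a b)"
      using continuous_on_subset[OF smooth_on_frechet_continuous[OF transition_smooth[OF c V]]]
      by (intro continuous_on_compose continuous_on_linepath) auto
    show "((\<psi> \<circ> ?\<gamma>) has_vector_derivative (?D \<circ> linepath a b) t) (at t within T)" if "t \<in> T" for t
      using chart_segment_derivative(2)[OF V] that T by simp
  qed
  ultimately have "C1_arc A 0 1 ?\<gamma>"
    unfolding C1_arc_def Let_def by auto
  \<comment> \<open>There is a single arc, with break points \<open>real 0\<close> and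
    \<open>real 1\<close>.\<close>
  then show ?thesis
    unfolding piecewise_C1_curve_def
    by (intro exI[of _ 1] exI[of _ real]) auto
qed

text \<open>The speed is computed in some chart \<open>(V, \<psi>)\<close>, where the velocity is
  the image of \<open>b - a\<close> under the derivative of the transition map. The transformation
  law of the metric carries it back to \<open>(U, \<phi>)\<close>.\<close>

lemma chart_segment_speed:
  assumes t: "t \<in> {0..1}"
  shows "curve_speed A g (inv_into U \<phi> \<circ> linepath a b) t
    = sqrt (g (U, \<phi>) (inv_into U \<phi> (linepath a b t)) (b - a) (b - a))"
proof -
  let ?\<gamma> = "inv_into U \<phi> \<circ> linepath a b"
  obtain V \<psi> where V: "(V, \<psi>) \<in> A" "?\<gamma> t \<in> V" "(SOME c. c \<in> A \<and> ?\<gamma> t \<in> fst c) = (V, \<psi>)"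
    by (rule speed_chart[of "?\<gamma> t"]) auto
  let ?v = "frechet_derivative (transition (U, \<phi>) (V, \<psi>)) (at (linepath a b t)) (b - a)"
  have "((\<psi> \<circ> ?\<gamma>) has_vector_derivative ?v) (at t within cbox 0 1)"
    using chart_segment_derivative(2)[OF V(1) t] V(2) by simp
  then have "vector_derivative (\<psi> \<circ> ?\<gamma>) (at t within {0..1}) = ?v"
    using t by (metis box_real(2) vector_derivative_within_cbox zero_less_one)
  moreover have "linepath a b t \<in> \<phi> ` U"
    using chart_segment_derivative(1)[OF V(1) t] V(2) by auto
  then have "?\<gamma> t \<in> U" "\<phi> (?\<gamma> t) = linepath a b t"
    by (auto simp: inv_into_into f_inv_into_f)
  ultimately show ?thesis
    using metric_transform[OF c V(1), of "?\<gamma> t" "b - a" "b - a"] V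
    unfolding curve_speed_def by (simp add: Let_def)
qed

lemma chart_segment_length_le:
  assumes "\<And>y. y \<in> closed_segment a b \<Longrightarrow>
      g (U, \<phi>) (inv_into U \<phi> y) (b - a) (b - a) \<le> K * (norm (b - a))\<^sup>2"
  shows "curve_length A g (inv_into U \<phi> \<circ> linepath a b) \<le> sqrt K * norm (b - a)"
proof (cases "curve_speed A g (inv_into U \<phi> \<circ> linepath a b) integrable_on {0..1}")
  case True
  have "curve_speed A g (inv_into U \<phi> \<circ> linepath a b) t \<le> sqrt K * norm (b - a)"
    if "t \<in> {0..1}" for t
  proof -
    have "linepath a b t \<in> closed_segment a b"
      using that linepath_image_01 by blast
    from assms[OF this, THEN real_sqrt_le_mono] show ?thesis
      by (simp add: chart_segment_speed[OF that] real_sqrt_mult)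
  qed
  then have "integral {0..1} (curve_speed A g (inv_into U \<phi> \<circ> linepath a b))
      \<le> integral {0..1::real} (\<lambda>_. sqrt K * norm (b - a))"
    by (intro integral_le True) auto
  then show ?thesis
    by (simp add: curve_length_def)
next
  case False
  \<comment> \<open>The length is 0 by convention here, so the bound must be shown nonnegative. The
    hypothesis at the end point \<open>a\<close> gives this, as the metric is nonnegative
    there.\<close>
  have "0 \<le> K * (norm (b - a))\<^sup>2"
    using assms[of a] metric_nonneg[OF c, of "inv_into U \<phi> a" "b - a"]
      inv_into_into[of a \<phi> U] seg by (auto simp: subset_iff)
  then have "0 \<le> sqrt K * norm (b - a)"
    by (auto simp: zero_le_mult_iff)
  then show ?thesis
    using False by (simp add: curve_length_def not_integrable_integral)
qed

end

section \<open>Change of parameter and the length of a join\<close>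

lemma piecewise_C1_curve_differentiable:
  assumes "piecewise_C1_curve A \<gamma>"
  obtains F where "finite F"
    "\<And>t U \<phi>. t \<in> {0..1} - F \<Longrightarrow> (U, \<phi>) \<in> A \<Longrightarrow> \<gamma> t \<in> U \<Longrightarrow> (\<phi> \<circ> \<gamma>) differentiable (at t)"
proof -
  obtain n s where s: "s 0 = 0" "s n = 1" "\<And>i. i < n \<Longrightarrow> C1_arc A (s i) (s (Suc i)) \<gamma>"
    using assms unfolding piecewise_C1_curve_def by blast
  have "(\<phi> \<circ> \<gamma>) differentiable (at t)"
    if t: "t \<in> {0..1} - s ` {..n}" and c: "(U, \<phi>) \<in> A" and U: "\<gamma> t \<in> U" for t U \<phi>
  proof -
    obtain i where i: "i < n" "s i < t" "t < s (Suc i)"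
      using partition_cover[of s t n] s t by auto
    define T where "T = {u \<in> {s i..s (Suc i)}. \<gamma> u \<in> U}"
    obtain D where D: "\<And>t. t \<in> T \<Longrightarrow> ((\<phi> \<circ> \<gamma>) has_vector_derivative D t) (at t within T)"
      using s(3)[OF i(1)] c unfolding C1_arc_def Let_def T_def by fast
    have "continuous_on {s i<..<s (Suc i)} \<gamma>"
      using s(3)[OF i(1)] unfolding C1_arc_def by (auto elim: continuous_on_subset)
    then have "open ({s i<..<s (Suc i)} \<inter> \<gamma> -` U)"
      using chart_open_domain[OF c] by (intro continuous_open_preimage) auto
    \<comment> \<open>Away from the break points \<open>T\<close> contains an open set around
      \<open>t\<close>, so the derivative along the arc is two-sided.\<close>
    then have "at t within T = at t"
      using i U by (intro at_within_open_subset[of t "{s i<..<s (Suc i)} \<inter> \<gamma> -` U"])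
        (auto simp: T_def)
    moreover have "t \<in> T"
      using i U by (simp add: T_def)
    ultimately show ?thesis
      using D[of t] by (auto simp: differentiable_def has_vector_derivative_def)
  qed
  then show thesis
    using that[of "s ` {..n}"] by blast
qed

text \<open>The chart selected by \<open>curve_speed\<close> depends only on the point, so both
  curves are measured in the same chart. The velocity gains the factor \<open>m\<close>, which
  bilinearity turns into \<open>m * m\<close> under the root. Both times are interior to [0, 1], so
  the derivatives within [0, 1] are two-sided.\<close>

lemma curve_speed_reparam:
  assumes t: "a < t" "t < b" "0 \<le> a" "b \<le> 1" and m: "m > 0"
    and \<delta>: "\<And>t. t \<in> {a<..<b} \<Longrightarrow> \<delta> t = \<gamma> (m * t + k)"
    and u: "m * t + k \<in> {0<..<1}"
    and diff: "\<And>U \<phi>. (U, \<phi>) \<in> A \<Longrightarrow> \<gamma> (m * t + k) \<in> U \<Longrightarrow> (\<phi> \<circ> \<gamma>) differentiable (at (m * t + k))"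
  shows "curve_speed A g \<delta> t = m * curve_speed A g \<gamma> (m * t + k)"
proof -
  let ?u = "m * t + k"
  have \<delta>t: "\<delta> t = \<gamma> ?u"
    using \<delta> t by simp
  obtain U \<phi> where c: "(U, \<phi>) \<in> A" "\<gamma> ?u \<in> U" "(SOME c. c \<in> A \<and> \<gamma> ?u \<in> fst c) = (U, \<phi>)"
    by (rule speed_chart[of "\<gamma> ?u"]) auto
  define v where "v = vector_derivative (\<phi> \<circ> \<gamma>) (at ?u)"
  have v: "((\<phi> \<circ> \<gamma>) has_vector_derivative v) (at ?u)"
    unfolding v_def using diff[OF c(1,2)] by (simp add: vector_derivative_works)
  have "((\<lambda>t. m * t + k) has_vector_derivative m) (at t)"
    by (auto intro!: derivative_eq_intros simp: has_vector_derivative_def)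
  from vector_diff_chain_at[OF this v]
  have "((\<phi> \<circ> \<delta>) has_vector_derivative m *\<^sub>R v) (at t)"
    by (rule has_vector_derivative_transform_within_open[of _ _ _ "{a<..<b}"]) (use t \<delta> in auto)
  moreover have "at t within {0..1} = at t" "at ?u within {0..1} = at ?u"
    using t u by (auto intro!: at_within_Icc_at)
  ultimately have
    "vector_derivative (\<phi> \<circ> \<delta>) (at t within {0..1}) = m *\<^sub>R v"
    "vector_derivative (\<phi> \<circ> \<gamma>) (at ?u within {0..1}) = v"
    by (auto simp: vector_derivative_at v_def)
  moreover have "bilinear (g (U, \<phi>) (\<gamma> ?u))"
    using metric_bilinear c by simp
  note bilinear_lmul[OF this, of m v "m *\<^sub>R v"] bilinear_rmul[OF this, of v m v]
  moreover have "sqrt (m * (m * x)) = m * sqrt x" for x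
    using m by (simp add: real_sqrt_mult flip: mult.assoc)
  ultimately show ?thesis
    unfolding curve_speed_def \<delta>t c(3) Let_def by simp
qed

text \<open>Substitution in the integral. The two speeds correspond except at the end points and at
  the finitely many times where \<open>\<gamma>\<close> may fail to be differentiable, and a finite
  set does not affect the integral. Integrability is assumed for \<open>\<delta>\<close> and passes
  to \<open>\<gamma>\<close>.\<close>

lemma integral_speed_reparam:
  assumes \<gamma>: "piecewise_C1_curve A \<gamma>" and ab: "a < b" "0 \<le> a" "b \<le> 1"
    and m: "m > 0" "m * a + k = 0" "m * b + k = 1"
    and \<delta>: "\<And>t. t \<in> {a<..<b} \<Longrightarrow> \<delta> t = \<gamma> (m * t + k)"
    and int: "curve_speed A g \<delta> integrable_on {a..b}"
  shows "integral {a..b} (curve_speed A g \<delta>) = curve_length A g \<gamma>"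
proof -
  obtain F where F: "finite F"
    "\<And>t U \<phi>. t \<in> {0..1} - F \<Longrightarrow> (U, \<phi>) \<in> A \<Longrightarrow> \<gamma> t \<in> U \<Longrightarrow> (\<phi> \<circ> \<gamma>) differentiable (at t)"
    using piecewise_C1_curve_differentiable[OF \<gamma>] by blast
  define J where "J = integral {a..b} (curve_speed A g \<delta>)"
  have "(curve_speed A g \<delta> has_integral J) (cbox a b)"
    using int by (simp add: J_def integrable_integral)
  \<comment> \<open>The factor 1 / m and the offset -(k / m) describe the inverse of the map from t
    to m * t + k.\<close>
  from has_integral_affinity[OF this, of "1/m" "- (k/m)"]
  have "((\<lambda>x. curve_speed A g \<delta> ((x - k) / m)) has_integral m * J) ((\<lambda>x. m * x + k) ` {a..b})"
    using m(1) by (simp add: diff_divide_distrib)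
  moreover have "(\<lambda>x. m * x + k) ` {a..b} = {0..1}"
    using m ab by (simp add: image_affinity_atLeastAtMost)
  ultimately have "((\<lambda>x. curve_speed A g \<delta> ((x - k) / m)) has_integral m * J) {0..1}"
    by simp
  from has_integral_mult_right[OF this, of "1/m"]
  have "((\<lambda>x. 1/m * curve_speed A g \<delta> ((x - k) / m)) has_integral J) {0..1}"
    using m(1) by simp
  moreover have "curve_speed A g \<gamma> x = 1/m * curve_speed A g \<delta> ((x - k) / m)"
    if x: "x \<in> {0..1} - (F \<union> {0, 1})" for x
  proof -
    let ?t = "(x - k) / m"
    have mt: "m * ?t + k = x"
      using m by simp
    have "m * a + k < m * ?t + k" "m * ?t + k < m * b + k"
      unfolding mt m using x by auto
    then have "a < ?t" "?t < b"
      using m(1) by (auto simp only: add_less_cancel_right mult_less_cancel_left_pos)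
    then have "curve_speed A g \<delta> ?t = m * curve_speed A g \<gamma> (m * ?t + k)"
      using x ab m(1) \<delta> F(2)[of x] by (intro curve_speed_reparam[of a _ b]) (auto simp: mt)
    then show ?thesis
      using m(1) by (simp add: mt)
  qed
  ultimately have "(curve_speed A g \<gamma> has_integral J) {0..1}"
    using F(1)
    by (intro has_integral_spike_finite[of "F \<union> {0, 1}" "{0..1}" "curve_speed A g \<gamma>"
          "\<lambda>x. 1/m * curve_speed A g \<delta> ((x - k) / m)"]) (simp, blast, blast)
  then show ?thesis
    unfolding curve_length_def J_def by (rule integral_unique[symmetric])
qed

text \<open>No integrability of the speeds has to be proved: a curve whose speed is not integrable has
  length 0.\<close>

lemma curve_length_join:
  assumes c1: "piecewise_C1_curve A \<gamma>1" and c2: "piecewise_C1_curve A \<gamma>2"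
  shows "curve_length A g (\<gamma>1 +++ \<gamma>2) \<le> curve_length A g \<gamma>1 + curve_length A g \<gamma>2"
proof (cases "curve_speed A g (\<gamma>1 +++ \<gamma>2) integrable_on {0..1}")
  case True
  then have *: "curve_speed A g (\<gamma>1 +++ \<gamma>2) integrable_on {0..1/2}"
      "curve_speed A g (\<gamma>1 +++ \<gamma>2) integrable_on {1/2..1}"
    by (auto intro: integrable_subinterval_real)
  have "curve_length A g (\<gamma>1 +++ \<gamma>2) =
      integral {0..1/2} (curve_speed A g (\<gamma>1 +++ \<gamma>2)) + integral {1/2..1} (curve_speed A g (\<gamma>1 +++ \<gamma>2))"
    unfolding curve_length_def using True
    by (intro Henstock_Kurzweil_Integration.integral_combine[symmetric]) auto
  also have "integral {0..1/2} (curve_speed A g (\<gamma>1 +++ \<gamma>2)) = curve_length A g \<gamma>1"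
    using * by (intro integral_speed_reparam[where m = 2 and k = 0] c1) (auto simp: joinpaths_def)
  also have "integral {1/2..1} (curve_speed A g (\<gamma>1 +++ \<gamma>2)) = curve_length A g \<gamma>2"
    using * by (intro integral_speed_reparam[where m = 2 and k = "-1"] c2) (auto simp: joinpaths_def)
  finally show ?thesis by simp
next
  case False
  then show ?thesis
    using curve_length_nonneg[of \<gamma>1] curve_length_nonneg[of \<gamma>2]
    by (simp add: curve_length_def not_integrable_integral)
qed

section \<open>The triangle inequality and small neighbourhoods\<close>

definition joined :: "'a \<Rightarrow> 'a \<Rightarrow> bool" where
  "joined p q \<longleftrightarrow> (\<exists>\<gamma>. piecewise_C1_curve A \<gamma> \<and> pathstart \<gamma> = p \<and> pathfinish \<gamma> = q)"

lemma joined_trans: "joined p q \<Longrightarrow> joined q r \<Longrightarrow> joined p r"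
  unfolding joined_def
  by (elim exE conjE) (rule exI, intro conjI, rule piecewise_C1_curve_join, auto)

lemma geodesic_dist_le:
  "piecewise_C1_curve A \<gamma> \<Longrightarrow> geodesic_dist A g (pathstart \<gamma>) (pathfinish \<gamma>) \<le> curve_length A g \<gamma>"
  unfolding geodesic_dist_def
  by (rule cInf_lower) (auto intro!: bdd_belowI[of _ 0] curve_length_nonneg)

text \<open>The infimum of an empty set of reals carries no information, so a lower bound asks for
  at least one connecting curve.\<close>

lemma geodesic_dist_greatest:
  assumes "joined p q"
    and "\<And>\<gamma>. piecewise_C1_curve A \<gamma> \<Longrightarrow> pathstart \<gamma> = p \<Longrightarrow> pathfinish \<gamma> = q \<Longrightarrow> l \<le> curve_length A g \<gamma>"
  shows "l \<le> geodesic_dist A g p q"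
  unfolding geodesic_dist_def
  by (rule cInf_greatest) (use assms in \<open>auto simp: joined_def\<close>)

lemma geodesic_dist_triangle:
  assumes pq: "joined p q" and qr: "joined q r"
  shows "geodesic_dist A g p r \<le> geodesic_dist A g p q + geodesic_dist A g q r"
proof -
  have "geodesic_dist A g p r \<le> curve_length A g \<gamma>1 + curve_length A g \<gamma>2"
    if 1: "piecewise_C1_curve A \<gamma>1" "pathstart \<gamma>1 = p" "pathfinish \<gamma>1 = q"
      and 2: "piecewise_C1_curve A \<gamma>2" "pathstart \<gamma>2 = q" "pathfinish \<gamma>2 = r" for \<gamma>1 \<gamma>2
    using geodesic_dist_le[OF piecewise_C1_curve_join[of A \<gamma>1 \<gamma>2]] curve_length_join[of \<gamma>1 \<gamma>2] 1 2
    by simp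
  \<comment> \<open>The infimum is taken over \<open>\<gamma>2\<close> first, with
    \<open>\<gamma>1\<close> fixed, and then over \<open>\<gamma>1\<close>.\<close>
  then have "geodesic_dist A g p r - curve_length A g \<gamma>1 \<le> geodesic_dist A g q r"
    if "piecewise_C1_curve A \<gamma>1" "pathstart \<gamma>1 = p" "pathfinish \<gamma>1 = q" for \<gamma>1
    using that by (intro geodesic_dist_greatest[OF qr]) (subst diff_le_eq, subst add.commute, blast)
  then have "geodesic_dist A g p r - geodesic_dist A g q r \<le> geodesic_dist A g p q"
    by (intro geodesic_dist_greatest[OF pq]) (auto simp: algebra_simps)
  then show ?thesis by simp
qed

lemma chart_preimage_ball_open:
  assumes "(U, \<phi>) \<in> A"
  shows "open {y \<in> U. \<phi> y \<in> ball a r}"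
proof -
  have "open (U \<inter> \<phi> -` ball a r)"
    using chart_continuous[OF assms] chart_open_domain[OF assms]
    by (rule continuous_open_preimage) auto
  then show ?thesis
    by (simp add: Int_def vimage_def)
qed

text \<open>\<open>W\<close> is the preimage of a small coordinate ball. Balls are convex, so any
  two points of \<open>W\<close> are joined by a coordinate segment; the one from \<open>x\<close>
  to \<open>y\<close> has length at most \<open>sqrt K\<close> times the coordinate
  distance.\<close>

lemma nearby_joined:
  assumes "e > 0"
  obtains W where "open W" "x \<in> W" "\<And>y z. y \<in> W \<Longrightarrow> z \<in> W \<Longrightarrow> joined y z"
    "\<And>y. y \<in> W \<Longrightarrow> geodesic_dist A g x y < e"
proof -
  obtain U \<phi> where c: "(U, \<phi>) \<in> A" and x: "x \<in> U"
    by (rule chart_at)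
  obtain r K where r: "r > 0" "K \<ge> 0" "ball (\<phi> x) r \<subseteq> \<phi> ` U"
    and K: "\<And>y w. y \<in> ball (\<phi> x) r \<Longrightarrow> g (U, \<phi>) (inv_into U \<phi> y) w w \<le> K * (norm w)\<^sup>2"
    using metric_locally_bounded[OF c x] by blast
  \<comment> \<open>The minimum with \<open>r\<close> stays where the metric bound holds; the
    summand 1 keeps the divisor positive when \<open>K = 0\<close>.\<close>
  define \<rho> where "\<rho> = min r (e / (sqrt K + 1))"
  have pos: "0 < sqrt K + 1"
    using r(2) by (simp add: add_nonneg_pos)
  have \<rho>: "\<rho> > 0" "\<rho> \<le> r"
    using assms r pos by (auto simp: \<rho>_def)
  define W where "W = {y \<in> U. \<phi> y \<in> ball (\<phi> x) \<rho>}"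
  let ?\<gamma> = "\<lambda>y z. inv_into U \<phi> \<circ> linepath (\<phi> y) (\<phi> z)"
  have seg: "closed_segment (\<phi> y) (\<phi> z) \<subseteq> ball (\<phi> x) \<rho>" if "y \<in> W" "z \<in> W" for y z
    using that by (intro closed_segment_subset convex_ball) (auto simp: W_def)
  then have seg': "closed_segment (\<phi> y) (\<phi> z) \<subseteq> \<phi> ` U" if "y \<in> W" "z \<in> W" for y z
    using that \<rho>(2) r(3) by (meson order_trans subset_ball)
  have \<gamma>: "piecewise_C1_curve A (?\<gamma> y z)" "pathstart (?\<gamma> y z) = y" "pathfinish (?\<gamma> y z) = z"
    if "y \<in> W" "z \<in> W" for y z
    using chart_segment_curve[OF c seg'[OF that]] that
    by (auto simp: pathstart_compose pathfinish_compose chart_inverse[OF c] W_def)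
  have xW: "x \<in> W"
    using x \<rho> by (simp add: W_def)
  have "geodesic_dist A g x y < e" if y: "y \<in> W" for y
  proof -
    have "geodesic_dist A g x y \<le> curve_length A g (?\<gamma> x y)"
      using geodesic_dist_le[of "?\<gamma> x y"] \<gamma>[OF xW y] by simp
    also have "\<dots> \<le> sqrt K * norm (\<phi> y - \<phi> x)"
      using seg[OF xW y] \<rho>(2)
      by (intro chart_segment_length_le[OF c seg'[OF xW y]] K) (auto simp: subset_iff)
    also have "\<dots> \<le> (sqrt K + 1) * norm (\<phi> y - \<phi> x)"
      by (simp add: mult_right_mono)
    also have "\<dots> < (sqrt K + 1) * (e / (sqrt K + 1))"
      using y pos by (intro mult_strict_left_mono) (auto simp: W_def \<rho>_def dist_norm norm_minus_commute)
    also have "\<dots> = e"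
      using pos by simp
    finally show ?thesis .
  qed
  moreover have "joined y z" if "y \<in> W" "z \<in> W" for y z
    using \<gamma>[OF that] by (auto simp: joined_def)
  moreover have "open W"
    unfolding W_def by (rule chart_preimage_ball_open[OF c])
  ultimately show thesis
    using xW that by blast
qed

end

section \<open>Global connection by curves, measurability and integrability of the distance\<close>

context complete_connected_riemannian_manifold
begin

text \<open>Being joined to \<open>p\<close> is locally constant, since every point has a
  neighbourhood whose points are mutually joined. Connectedness then spreads the property from
  \<open>p\<close> to the whole manifold.\<close>

lemma all_joined: "joined p q"
proof (rule connected_induction_simple[where P = "joined p" and S = UNIV and a = p])
  show "\<exists>T. openin (top_of_set UNIV) T \<and> a \<in> T \<and> (\<forall>x\<in>T. \<forall>y\<in>T. joined p x \<longrightarrow> joined p y)" for a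
  proof -
    obtain W where "open W" "a \<in> W" "\<And>y z. y \<in> W \<Longrightarrow> z \<in> W \<Longrightarrow> joined y z"
      by (rule nearby_joined[OF zero_less_one, of a]) blast
    then show ?thesis
      by (intro exI[of _ W]) (auto intro: joined_trans)
  qed
  \<comment> \<open>Both points of the neighbourhood are taken to be \<open>p\<close>.\<close>
  show "joined p p"
    by (rule nearby_joined[OF zero_less_one, of p]) blast
qed (auto simp: manifold_connected)

lemma geodesic_dist_nonneg: "0 \<le> geodesic_dist A g p q"
  using all_joined curve_length_nonneg by (rule geodesic_dist_greatest)

lemma geodesic_dist_borel: "geodesic_dist A g p \<in> borel_measurable borel"
proof (rule borel_measurableI_less)
  fix c
  have "open {x. geodesic_dist A g p x < c}"
  proof (rule open_subopen[THEN iffD2], rule ballI)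
    fix x assume "x \<in> {x. geodesic_dist A g p x < c}"
    \<comment> \<open>The allowed distance from \<open>x\<close> is the margin left below
      \<open>c\<close>, so the triangle inequality keeps all of \<open>W\<close> in the sublevel
      set.\<close>
    then obtain W where W: "open W" "x \<in> W"
        "\<And>y. y \<in> W \<Longrightarrow> geodesic_dist A g x y < c - geodesic_dist A g p x"
      using nearby_joined[of "c - geodesic_dist A g p x" x]
      by (metis diff_gt_0_iff_gt mem_Collect_eq)
    have "geodesic_dist A g p y < c" if "y \<in> W" for y
      using W(3)[OF that] geodesic_dist_triangle[OF all_joined all_joined, of p y x] by simp
    with W show "\<exists>T. open T \<and> x \<in> T \<and> T \<subseteq> {x. geodesic_dist A g p x < c}"
      by blast
  qed
  then show "{x \<in> space borel. geodesic_dist A g p x < c} \<in> sets borel"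
    by simp
qed

text \<open>By the triangle inequality through \<open>p0\<close> the distance is dominated by a
  constant plus an integrable function, and constants are integrable for a finite measure.\<close>

lemma geodesic_dist_integrable:
  assumes X: "X \<in> measurable M borel" "finite_measure M"
    and fin: "(\<integral>\<^sup>+\<omega>. ennreal (geodesic_dist A g p0 (X \<omega>)) \<partial>M) < \<infinity>"
  shows "integrable M (\<lambda>\<omega>. geodesic_dist A g p (X \<omega>))"
proof -
  interpret finite_measure M by (rule X)
  have meas: "(\<lambda>\<omega>. geodesic_dist A g p (X \<omega>)) \<in> borel_measurable M" for p
    by (rule measurable_compose[OF X(1) geodesic_dist_borel])
  have "integrable M (\<lambda>\<omega>. geodesic_dist A g p0 (X \<omega>))"
    using fin by (intro integrableI_nonneg meas) (auto simp: geodesic_dist_nonneg)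
  then have "integrable M (\<lambda>\<omega>. geodesic_dist A g p p0 + geodesic_dist A g p0 (X \<omega>))"
    by (intro Bochner_Integration.integrable_add integrable_const)
  then show ?thesis
    by (rule Bochner_Integration.integrable_bound)
      (auto simp: meas geodesic_dist_nonneg geodesic_dist_triangle[OF all_joined all_joined])
qed

end

section \<open>Means of weighted distances\<close>

text \<open>After squaring, the gap is twice the variance of a variable that takes the values
  \<open>a\<close> and \<open>b\<close> with probabilities \<alpha> / 2 and 1 - \<alpha> /
  2.\<close>

lemma sqrt_weighted_ge:
  fixes a b \<alpha> :: real
  assumes "0 \<le> \<alpha>" "\<alpha> \<le> 2" "0 \<le> a" "0 \<le> b"
  shows "sqrt 2 * (\<alpha> / 2 * a + (1 - \<alpha> / 2) * b) \<le> sqrt (\<alpha> * a\<^sup>2 + (2 - \<alpha>) * b\<^sup>2)"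
proof (rule real_le_rsqrt)
  have "(\<alpha> * a\<^sup>2 + (2 - \<alpha>) * b\<^sup>2) - 2 * (\<alpha> / 2 * a + (1 - \<alpha> / 2) * b)\<^sup>2
      = \<alpha> * (2 - \<alpha>) / 2 * (a - b)\<^sup>2"
    by (simp add: power2_eq_square field_simps)
  also have "\<dots> \<ge> 0"
    using assms by simp
  finally show "(sqrt 2 * (\<alpha> / 2 * a + (1 - \<alpha> / 2) * b))\<^sup>2 \<le> \<alpha> * a\<^sup>2 + (2 - \<alpha>) * b\<^sup>2"
    by (simp add: power_mult_distrib)
qed

lemma sqrt_weighted_le:
  fixes a b \<alpha> :: real
  assumes "0 \<le> \<alpha>" "\<alpha> \<le> 2" "0 \<le> a" "0 \<le> b"
  shows "sqrt (\<alpha> * a\<^sup>2 + (2 - \<alpha>) * b\<^sup>2) \<le> sqrt \<alpha> * a + sqrt (2 - \<alpha>) * b"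
  using sqrt_add_le_add_sqrt[of "\<alpha> * a\<^sup>2" "(2 - \<alpha>) * b\<^sup>2"] assms
  by (simp add: real_sqrt_mult)

text \<open>Reaches the excluded end point 2 by a left limit, in which the second summand
  vanishes.\<close>

lemma le_of_le_near_2:
  fixes c a b :: real
  assumes "\<And>\<alpha>. 0 < \<alpha> \<Longrightarrow> \<alpha> < 2 \<Longrightarrow> c \<le> sqrt \<alpha> * a + sqrt (2 - \<alpha>) * b"
  shows "c \<le> sqrt 2 * a"
proof (rule tendsto_lowerbound)
  have "((\<lambda>\<alpha>. sqrt \<alpha> * a + sqrt (2 - \<alpha>) * b) \<longlongrightarrow> sqrt 2 * a + sqrt (2 - 2) * b) (at_left 2)"
    by (intro tendsto_intros)
  then show "((\<lambda>\<alpha>. sqrt \<alpha> * a + sqrt (2 - \<alpha>) * b) \<longlongrightarrow> sqrt 2 * a) (at_left 2)"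
    by simp
  show "\<forall>\<^sub>F \<alpha> in at_left 2. c \<le> sqrt \<alpha> * a + sqrt (2 - \<alpha>) * b"
    using eventually_at_left_real[of 0 2] by (rule eventually_mono) (auto intro: assms)
qed simp

section \<open>The infimum formula for abstract nonnegative integrable distances\<close>

context prob_space
begin

context
  fixes dM :: "'b \<Rightarrow> 'b \<Rightarrow> real" and dN :: "'c \<Rightarrow> 'c \<Rightarrow> real" and X Y
  assumes nonneg: "\<And>p x. 0 \<le> dM p x" "\<And>q y. 0 \<le> dN q y"
    and int: "\<And>p. integrable M (\<lambda>\<omega>. dM p (X \<omega>))" "\<And>q. integrable M (\<lambda>\<omega>. dN q (Y \<omega>))"
begin

lemma weighted_dist_integrable:
  assumes "0 \<le> \<alpha>" "\<alpha> \<le> 2"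
  shows "integrable M (\<lambda>\<omega>. weighted_dist dM dN \<alpha> (p, q) (X \<omega>, Y \<omega>))"
proof (rule Bochner_Integration.integrable_bound)
  show "integrable M (\<lambda>\<omega>. sqrt \<alpha> * dM p (X \<omega>) + sqrt (2 - \<alpha>) * dN q (Y \<omega>))"
    by (intro Bochner_Integration.integrable_add integrable_mult_right int)
  have [measurable]: "(\<lambda>\<omega>. dM p (X \<omega>)) \<in> borel_measurable M" "(\<lambda>\<omega>. dN q (Y \<omega>)) \<in> borel_measurable M"
    using int by auto
  show "(\<lambda>\<omega>. weighted_dist dM dN \<alpha> (p, q) (X \<omega>, Y \<omega>)) \<in> borel_measurable M"
    unfolding weighted_dist_def fst_conv snd_conv by measurable
  show "AE \<omega> in M. norm (weighted_dist dM dN \<alpha> (p, q) (X \<omega>, Y \<omega>))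
      \<le> norm (sqrt \<alpha> * dM p (X \<omega>) + sqrt (2 - \<alpha>) * dN q (Y \<omega>))"
    using sqrt_weighted_le[OF assms nonneg] assms nonneg
    by (auto simp: weighted_dist_def)
qed

lemma mean_weighted_dist_le:
  assumes "0 \<le> \<alpha>" "\<alpha> \<le> 2"
  shows "mean_weighted_dist dM dN M (\<lambda>\<omega>. (X \<omega>, Y \<omega>)) \<alpha> (p, q)
    \<le> sqrt \<alpha> * expectation (\<lambda>\<omega>. dM p (X \<omega>)) + sqrt (2 - \<alpha>) * expectation (\<lambda>\<omega>. dN q (Y \<omega>))"
proof -
  have "mean_weighted_dist dM dN M (\<lambda>\<omega>. (X \<omega>, Y \<omega>)) \<alpha> (p, q)
      \<le> expectation (\<lambda>\<omega>. sqrt \<alpha> * dM p (X \<omega>) + sqrt (2 - \<alpha>) * dN q (Y \<omega>))"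
    unfolding mean_weighted_dist_def
    by (intro integral_mono weighted_dist_integrable assms Bochner_Integration.integrable_add
        integrable_mult_right int)
      (simp add: weighted_dist_def sqrt_weighted_le[OF assms nonneg])
  also have "\<dots> = sqrt \<alpha> * expectation (\<lambda>\<omega>. dM p (X \<omega>)) + sqrt (2 - \<alpha>) * expectation (\<lambda>\<omega>. dN q (Y \<omega>))"
    by (simp add: int)
  finally show ?thesis .
qed

lemma mean_weighted_dist_ge:
  assumes "0 \<le> \<alpha>" "\<alpha> \<le> 2"
  shows "sqrt 2 * (\<alpha> / 2 * expectation (\<lambda>\<omega>. dM p (X \<omega>)) + (1 - \<alpha> / 2) * expectation (\<lambda>\<omega>. dN q (Y \<omega>)))
    \<le> mean_weighted_dist dM dN M (\<lambda>\<omega>. (X \<omega>, Y \<omega>)) \<alpha> (p, q)"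
proof -
  have "sqrt 2 * (\<alpha> / 2 * expectation (\<lambda>\<omega>. dM p (X \<omega>)) + (1 - \<alpha> / 2) * expectation (\<lambda>\<omega>. dN q (Y \<omega>)))
      = expectation (\<lambda>\<omega>. sqrt 2 * (\<alpha> / 2 * dM p (X \<omega>) + (1 - \<alpha> / 2) * dN q (Y \<omega>)))"
    by (simp add: int del: times_divide_eq_left)
  also have "\<dots> \<le> mean_weighted_dist dM dN M (\<lambda>\<omega>. (X \<omega>, Y \<omega>)) \<alpha> (p, q)"
    unfolding mean_weighted_dist_def
    by (intro integral_mono weighted_dist_integrable assms Bochner_Integration.integrable_add
        integrable_mult_right int)
      (use sqrt_weighted_ge[OF assms nonneg] in \<open>simp add: weighted_dist_def\<close>)
  finally show ?thesis .
qed

lemma INF_mean_weighted_dist: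
  "(INF (m, \<alpha>) \<in> UNIV \<times> {0<..<2}. mean_weighted_dist dM dN M (\<lambda>\<omega>. (X \<omega>, Y \<omega>)) \<alpha> m) =
     sqrt 2 * min (INF p. expectation (\<lambda>\<omega>. dM p (X \<omega>))) (INF q. expectation (\<lambda>\<omega>. dN q (Y \<omega>)))"
    (is "?I = sqrt 2 * min ?a ?b")
proof (rule antisym)
  let ?F = "\<lambda>m \<alpha>. mean_weighted_dist dM dN M (\<lambda>\<omega>. (X \<omega>, Y \<omega>)) \<alpha> m"
  have E: "0 \<le> expectation (\<lambda>\<omega>. dM p (X \<omega>))" "0 \<le> expectation (\<lambda>\<omega>. dN q (Y \<omega>))" for p q
    by (simp_all add: nonneg)
  have "bdd_below ((\<lambda>(m, \<alpha>). ?F m \<alpha>) ` (UNIV \<times> {0<..<2}))"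
    by (rule bdd_belowI[of _ 0])
      (auto simp: mean_weighted_dist_def weighted_dist_def nonneg intro!: Bochner_Integration.integral_nonneg)
  then have I: "?I \<le> ?F (p, q) \<alpha>" if "0 < \<alpha>" "\<alpha> < 2" for p q \<alpha>
    using that by (intro cINF_lower2[of _ _ "((p, q), \<alpha>)"]) auto
  have "?I \<le> sqrt 2 * expectation (\<lambda>\<omega>. dM p (X \<omega>))" for p
    by (rule le_of_le_near_2, rule order_trans[OF I mean_weighted_dist_le]) auto
  then have Ia: "?I / sqrt 2 \<le> ?a"
    by (intro cINF_greatest) (auto simp: divide_le_eq mult.commute)
  \<comment> \<open>The end point 0 is reached by replacing \<alpha> with 2 - \<alpha>. The point in
    the first factor is arbitrary, because its term vanishes in the limit; \<open>undefined\<close>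
    serves as one.\<close>
  have "?I \<le> sqrt 2 * expectation (\<lambda>\<omega>. dN q (Y \<omega>))" for q
  proof (rule le_of_le_near_2)
    fix \<alpha> :: real assume "0 < \<alpha>" "\<alpha> < 2"
    then show "?I \<le> sqrt \<alpha> * expectation (\<lambda>\<omega>. dN q (Y \<omega>))
        + sqrt (2 - \<alpha>) * expectation (\<lambda>\<omega>. dM undefined (X \<omega>))"
      using I[of "2 - \<alpha>" undefined q] mean_weighted_dist_le[of "2 - \<alpha>" undefined q] by simp
  qed
  then have "?I / sqrt 2 \<le> ?b"
    by (intro cINF_greatest) (auto simp: divide_le_eq mult.commute)
  with Ia have "?I / sqrt 2 \<le> min ?a ?b"
    by (rule min.boundedI)
  then show "?I \<le> sqrt 2 * min ?a ?b"
    by (simp only: pos_divide_le_eq mult.commute real_sqrt_gt_0_iff zero_less_numeral)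
  have "sqrt 2 * min ?a ?b \<le> ?F (p, q) \<alpha>" if \<alpha>: "0 < \<alpha>" "\<alpha> < 2" for p q \<alpha>
  proof -
    have "?a \<le> expectation (\<lambda>\<omega>. dM p (X \<omega>))" "?b \<le> expectation (\<lambda>\<omega>. dN q (Y \<omega>))"
      using E by (auto intro!: cINF_lower bdd_belowI[of _ 0])
    \<comment> \<open>The weights sum to 1, so the left side is the minimum itself.\<close>
    then have "\<alpha> / 2 * min ?a ?b + (1 - \<alpha> / 2) * min ?a ?b
        \<le> \<alpha> / 2 * expectation (\<lambda>\<omega>. dM p (X \<omega>)) + (1 - \<alpha> / 2) * expectation (\<lambda>\<omega>. dN q (Y \<omega>))"
      using \<alpha> by (intro add_mono mult_left_mono) auto
    then have "sqrt 2 * min ?a ?b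
        \<le> sqrt 2 * (\<alpha> / 2 * expectation (\<lambda>\<omega>. dM p (X \<omega>)) + (1 - \<alpha> / 2) * expectation (\<lambda>\<omega>. dN q (Y \<omega>)))"
      by (intro mult_left_mono) (simp_all add: algebra_simps)
    also have "\<dots> \<le> ?F (p, q) \<alpha>"
      using \<alpha> by (intro mean_weighted_dist_ge) auto
    finally show ?thesis .
  qed
  then show "sqrt 2 * min ?a ?b \<le> ?I"
    by (intro cINF_greatest) auto
qed

end

end

theorem corollary9:
  fixes A :: "('a::{t2_space, second_countable_topology}, 'e::real_inner) chart set"
    and gM :: "('a, 'e) chart \<Rightarrow> 'a \<Rightarrow> 'e \<Rightarrow> 'e \<Rightarrow> real"
    and B :: "('b::{t2_space, second_countable_topology}, 'f::real_inner) chart set"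
    and gN :: "('b, 'f) chart \<Rightarrow> 'b \<Rightarrow> 'f \<Rightarrow> 'f \<Rightarrow> real"
    and P :: "'w measure"
    and X :: "'w \<Rightarrow> 'a" and Y :: "'w \<Rightarrow> 'b"
    and p0 :: 'a and q0 :: 'b
  defines "dM \<equiv> geodesic_dist A gM"
    and "dN \<equiv> geodesic_dist B gN"
  assumes "complete_connected_riemannian_manifold A gM"
    and "complete_connected_riemannian_manifold B gN"
    and "prob_space P"
    and "(\<lambda>\<omega>. (X \<omega>, Y \<omega>)) \<in> measurable P borel"
    and "(\<integral>\<^sup>+\<omega>. ennreal (dM p0 (X \<omega>)) \<partial>P) < \<infinity>"
    and "(\<integral>\<^sup>+\<omega>. ennreal (dN q0 (Y \<omega>)) \<partial>P) < \<infinity>"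
  shows "(INF (m, \<alpha>) \<in> UNIV \<times> {0<..<2}.
            mean_weighted_dist dM dN P (\<lambda>\<omega>. (X \<omega>, Y \<omega>)) \<alpha> m) =
         sqrt 2 * min (INF p. prob_space.expectation P (\<lambda>\<omega>. dM p (X \<omega>)))
                      (INF q. prob_space.expectation P (\<lambda>\<omega>. dN q (Y \<omega>)))"
proof -
  interpret M: complete_connected_riemannian_manifold A gM by fact
  interpret N: complete_connected_riemannian_manifold B gN by fact
  interpret prob_space P by fact
  \<comment> \<open>The pair is measurable for the Borel sets of the product topology; composing
    with the continuous projections gives its components.\<close>
  have "X \<in> measurable P borel" "Y \<in> measurable P borel"
    using measurable_compose[OF assms(6) borel_measurable_continuous_onI[OF continuous_on_fst[OF continuous_on_id]]]
      measurable_compose[OF assms(6) borel_measurable_continuous_onI[OF continuous_on_snd[OF continuous_on_id]]]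
    by simp_all
  then show ?thesis
    unfolding dM_def dN_def using assms(7,8)
    by (intro INF_mean_weighted_dist M.geodesic_dist_nonneg N.geodesic_dist_nonneg
        M.geodesic_dist_integrable[where ?p0.0 = p0] N.geodesic_dist_integrable[where ?p0.0 = q0]
        finite_measure_axioms) (simp_all add: dM_def dN_def)
qed

end
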